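(* Let $a,b,c,d,e,f$ be nonzero complex numbers, $s=\dfrac{a^3q^3}{bcdef}$, and suppose that one of $\frac{aq}{b},\frac{aq}{c},\frac{aq}{d},\frac{aq}{e},\frac{aq}{f}$ equals $q^{-N}$ for some $N\in\{0,1,2,\dots\}$. Let $a_n,b_n$ be as in the context. Then $$\cfrac{1}{a_0-\cfrac{b_1}{a_1-\cfrac{b_2}{a_2-\cdots-\cfrac{b_N}{a_N}}}}=\frac{aq}{s}\,\frac{1-aq}{(1-b)(1-c)(1-d)(1-e)(1-f)}\;{}_{10}W_9\Bigl(aq;q,\tfrac{aq^2}{s},\tfrac{aq}{b},\tfrac{aq}{c},\tfrac{aq}{d},\tfrac{aq}{e},\tfrac{aq}{f};q\Bigr).$$
   Context: Throughout $q\in\mathbb C$, $0<|q|<1$; $(x)_0=1$, $(x)_k=\prod_{j=0}^{k-1}(1-xq^j)$, $(x_1,\dots,x_r)_k=\prod_i (x_i)_k$. Products over letters are with multiplicity. The balanced very-well-poised series is $${}_{10}W_9(a;p_1,\dots,p_7;q)=\sum_{k\ge0} \frac{1-aq^{2k}}{1-a}\,\frac{(a,p_1,\dots,p_7)_k}{(q,aq/p_1,\dots,aq/p_7)_k}\,q^k,\qquad p_1p_2\cdots p_7=a^3q^2,$$ which terminates when one of the $p_i$ is $q^{-N}$. The coefficients are $$a_n=A_n+B_n+\frac{sq^{2n-1}}{a}\,\frac{(1-\frac{s}{aq^2})(1-b)(1-c)(1-d)(1-e)(1-f)}{(1-aq^{n+1})(1-\frac{sq^{n-2}}{a})},\qquad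 b_n=A_{n-1}B_n,$$ $$A_n=\frac{(1-sq^{n-1})(1-\frac{sq^{n-1}}{a})\prod_{p\in\{b,c,d,e,f\}}(1-\frac{aq^{n+1}}{p})}{(1-sq^{2n})(1-sq^{2n-1})(1-aq^{n+1})},\qquad B_n=\frac{q(1-q^n)(1-aq^n)\prod_{p\in\{b,c,d,e,f\}}(1-\frac{psq^{n-2}}{a})}{(1-sq^{2n-1})(1-sq^{2n-2})(1-\frac{sq^{n-2}}{a})}.$$ Standing assumption: parameters are such that no zero denominators occur. *)

theory Defs
  imports Complex_Main
begin

definition qpoch :: "complex \<Rightarrow> complex \<Rightarrow> nat \<Rightarrow> complex" where
  "qpoch q x k = (\<Prod>j<k. 1 - x * q ^ j)"

text \<open>
  The very-well-poised series with leading parameter \<open>a\<close>; the list \<open>ps\<close> contains the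
  seven further parameters (so it is the \<open>10W9\<close> series when \<open>length ps = 7\<close>). If some
  entry of \<open>ps\<close> is \<open>q\<^sup>-\<^sup>N\<close>, all terms with \<open>k > N\<close> have a vanishing numerator, hence are \<open>0\<close>
  (also if their denominator happens to vanish), and the sum is a finite one.
  The balancing condition on \<open>ps\<close> is not part of the definition.
\<close>

definition vwp_series :: "complex \<Rightarrow> complex \<Rightarrow> complex list \<Rightarrow> complex" where
  "vwp_series q a ps =
     (\<Sum>k. (1 - a * q ^ (2 * k)) / (1 - a) *
          (qpoch q a k * (\<Prod>p\<leftarrow>ps. qpoch q p k)) /
          (qpoch q q k * (\<Prod>p\<leftarrow>ps. qpoch q (a * q / p) k)) * q ^ k)"

text \<open>
  Below, \<open>ps\<close> is the list \<open>[b, c, d, e, f]\<close>. The index \<open>n\<close> is an integer, so that shifted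
  indices such as \<open>n - 2\<close> are not truncated.
\<close>

definition coeff_A :: "complex \<Rightarrow> complex \<Rightarrow> complex \<Rightarrow> complex list \<Rightarrow> int \<Rightarrow> complex" where
  "coeff_A q a s ps n =
     (1 - s * q powi (n - 1)) * (1 - s * q powi (n - 1) / a) *
       (\<Prod>p\<leftarrow>ps. 1 - a * q powi (n + 1) / p) /
     ((1 - s * q powi (2 * n)) * (1 - s * q powi (2 * n - 1)) * (1 - a * q powi (n + 1)))"

definition coeff_B :: "complex \<Rightarrow> complex \<Rightarrow> complex \<Rightarrow> complex list \<Rightarrow> int \<Rightarrow> complex" where
  "coeff_B q a s ps n =
     q * (1 - q powi n) * (1 - a * q powi n) *
       (\<Prod>p\<leftarrow>ps. 1 - p * s * q powi (n - 2) / a) /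
     ((1 - s * q powi (2 * n - 1)) * (1 - s * q powi (2 * n - 2)) *
       (1 - s * q powi (n - 2) / a))"

definition coeff_a :: "complex \<Rightarrow> complex \<Rightarrow> complex \<Rightarrow> complex list \<Rightarrow> int \<Rightarrow> complex" where
  "coeff_a q a s ps n =
     coeff_A q a s ps n + coeff_B q a s ps n +
     s * q powi (2 * n - 1) / a *
       ((1 - s / (a * q ^ 2)) * (\<Prod>p\<leftarrow>ps. 1 - p) /
        ((1 - a * q powi (n + 1)) * (1 - s * q powi (n - 2) / a)))"

definition coeff_b :: "complex \<Rightarrow> complex \<Rightarrow> complex \<Rightarrow> complex list \<Rightarrow> int \<Rightarrow> complex" where
  "coeff_b q a s ps n = coeff_A q a s ps (n - 1) * coeff_B q a s ps n"

text \<open>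
  \<open>cf_tail \<alpha> \<beta> n m\<close> is the nested fraction
  \<open>\<alpha> n - \<beta> (n+1) / (\<alpha> (n+1) - \<beta> (n+2) / (\<dots> - \<beta> (n+m) / \<alpha> (n+m)))\<close>.
\<close>

fun cf_tail :: "(nat \<Rightarrow> complex) \<Rightarrow> (nat \<Rightarrow> complex) \<Rightarrow> nat \<Rightarrow> nat \<Rightarrow> complex" where
  "cf_tail \<alpha> \<beta> n 0 = \<alpha> n"
| "cf_tail \<alpha> \<beta> n (Suc m) = \<alpha> n - \<beta> (Suc n) / cf_tail \<alpha> \<beta> (Suc n) m"

end

(*
  Write x = a q^2 / s, let Y_(-1) = 1 and, for n >= 0,
    Y_n = sum_k (aq/s)^(n+1) (1 - a q^(2n+2k+1)) (aq)_(2n+k) (q^(n+1), x, a q^(n+1)/b, ..., a q^(n+1)/f)_k q^k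
            / ((q)_k (aq)_(n+k) (s q^(2n))_k (b, ..., f)_(n+k+1)),
  a multiple of the 10W9 series with leading parameter a q^(2n+1) and parameters q^(n+1), x,
  a q^(n+1)/b, ..., a q^(n+1)/f. These sums satisfy Y_(n-1) = a_n Y_n - b_(n+1) Y_(n+1), since the
  corresponding combination of their terms with indices k+2, k+1, k telescopes with the
  hypergeometric certificate H. As H vanishes at the end of the range, the tails t_n of the continued
  fraction satisfy t_n Y_n = Y_(n-1), and 1/t_0 = Y_0 is the claim. Below, X = 1/x = s/(a q^2), which
  makes all denominators polynomial, R t = prod (1 - p t) and T u = prod (1 - u/p), the products
  being over p = b, ..., f.
*)
theory Submission
  imports Defs
begin

section \<open>Clearing denominators, and q-shifted factorials\<close>

text \<open>Shaped for the recurrence: the bracket is \<open>a_n\<close> with its three fractions,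
  and \<open>D0 * D1 * D2 * E * G\<close> is a common denominator of all terms. What remains is a
  polynomial identity.\<close>

lemma divide_clear_denominators:
  fixes D0 D1 D2 E G :: complex
  assumes "D0 \<noteq> 0" "D1 \<noteq> 0" "D2 \<noteq> 0" "E \<noteq> 0" "G \<noteq> 0"
    and "n1 * D2 * E * G - (A * D0 * G + B * D2 * E + C * D0 * D1 * D2) * t + n3 * D0 * E * G =
      D0 * D1 * D2 * E * G * h"
  shows "n1 / (D0 * D1) - (A / (D2 * D1 * E) + B / (D1 * D0 * G) + C / (E * G)) * t + n3 / (D1 * D2) = h"
proof -
  have "D0 * D1 * D2 * E * G *
      (n1 / (D0 * D1) - (A / (D2 * D1 * E) + B / (D1 * D0 * G) + C / (E * G)) * t + n3 / (D1 * D2)) =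
    n1 * D2 * E * G - (A * D0 * G + B * D2 * E + C * D0 * D1 * D2) * t + n3 * D0 * E * G"
    using assms(1-5) by (simp add: field_simps)
  also note assms(6)
  finally show ?thesis
    using assms(1-5) by simp
qed

lemma qpoch_0 [simp]: "qpoch q x 0 = 1"
  by (simp add: qpoch_def)

lemma qpoch_Suc: "qpoch q x (Suc k) = qpoch q x k * (1 - x * q ^ k)"
  by (simp add: qpoch_def)

lemma qpoch_Suc_shift: "qpoch q x (Suc k) = (1 - x) * qpoch q (x * q) k"
  unfolding qpoch_def prod.lessThan_Suc_shift by (simp add: mult.assoc)

lemma qpoch_eq_0_iff: "qpoch q x k = 0 \<longleftrightarrow> (\<exists>j<k. x * q ^ j = 1)"
  by (auto simp: qpoch_def)

section \<open>The coefficients in terms of X and q^n\<close>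

text \<open>Substituting s = a q^2 X absorbs the negative powers of q, so all factors become
  polynomial in \<open>q^n\<close>, apart from the divisions by the parameters.\<close>

lemma coeff_A_nat:
  assumes "q \<noteq> 0" "a \<noteq> 0"
  shows "coeff_A q a (a * q^2 * X) ps (int n) =
    (1 - a*q*X*q^n) * (1 - q*X*q^n) * (\<Prod>p\<leftarrow>ps. 1 - a*q*q^n / p) /
    ((1 - a*q^2*X*(q^n)^2) * (1 - a*q*X*(q^n)^2) * (1 - a*q*q^n))"
proof -
  have "q powi (2 * int n) = (q^n)^2"
    by (metis of_nat_mult of_nat_numeral power_int_of_nat power_mult mult.commute)
  then show ?thesis
    using assms unfolding coeff_A_def
    by (simp add: power_int_diff power_int_add power2_eq_square mult_ac)
qed

lemma coeff_B_nat:
  assumes "q \<noteq> 0" "a \<noteq> 0"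
  shows "coeff_B q a (a * q^2 * X) ps (int n) =
    q * (1 - q^n) * (1 - a*q^n) * (\<Prod>p\<leftarrow>ps. 1 - p * (X*q^n)) /
    ((1 - a*q*X*(q^n)^2) * (1 - a*X*(q^n)^2) * (1 - X*q^n))"
proof -
  have "q powi (2 * int n) = (q^n)^2"
    by (metis of_nat_mult of_nat_numeral power_int_of_nat power_mult mult.commute)
  then show ?thesis
    using assms unfolding coeff_B_def
    by (simp add: power_int_diff power2_eq_square mult_ac)
qed

lemma coeff_a_nat:
  assumes "q \<noteq> 0" "a \<noteq> 0"
  shows "coeff_a q a (a * q^2 * X) ps (int n) =
    coeff_A q a (a * q^2 * X) ps (int n) + coeff_B q a (a * q^2 * X) ps (int n) +
    q*X*(q^n)^2 * (1 - X) * (\<Prod>p\<leftarrow>ps. 1 - p * 1) / ((1 - a*q*q^n) * (1 - X*q^n))"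
proof -
  have "q powi (2 * int n) = (q^n)^2"
    by (metis of_nat_mult of_nat_numeral power_int_of_nat power_mult mult.commute)
  then show ?thesis
    using assms unfolding coeff_a_def
    by (simp add: power_int_diff power_int_add power2_eq_square mult_ac)
qed

section \<open>The setting and the symmetric functions of the parameters\<close>

text \<open>\<open>aX_denom\<close> merges three families of denominators: s q^(2n), s q^(2n-1), s
  q^(2n-2) are a X q^m with m = 2n+2, 2n+1, 2n. \<open>balanced\<close> is the definition of s
  rewritten for X.\<close>

locale terminating_cf =
  fixes q a X :: complex and ps :: "complex list" and N :: nat
  assumes q: "0 < norm q" "norm q < 1"
    and a_nz: "a \<noteq> 0" and X_nz: "X \<noteq> 0"
    and length_ps: "length ps = 5" and ps_nz: "0 \<notin> set ps"
    and balanced: "X * prod_list ps = a^2 * q"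
    and aX_denom: "m \<le> 2*N + 2 \<Longrightarrow> a*X*q^m \<noteq> 1"
    and a_denom: "n \<le> N \<Longrightarrow> a*q*q^n \<noteq> 1"
    and X_denom: "n \<le> N \<Longrightarrow> X*q^n \<noteq> 1"
    and p_denom: "n \<le> N \<Longrightarrow> p \<in> set ps \<Longrightarrow> p*q^n \<noteq> 1"
    and terminating: "\<exists>p\<in>set ps. a*q*q^N = p"
begin

definition R :: "complex \<Rightarrow> complex" where "R t = (\<Prod>p\<leftarrow>ps. 1 - p * t)"

definition T :: "complex \<Rightarrow> complex" where "T u = (\<Prod>p\<leftarrow>ps. 1 - u / p)"

abbreviation (input) \<alpha> :: "nat \<Rightarrow> complex" where
  "\<alpha> n \<equiv> coeff_a q a (a * q^2 * X) ps (int n)"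

abbreviation (input) \<beta> :: "nat \<Rightarrow> complex" where
  "\<beta> n \<equiv> coeff_b q a (a * q^2 * X) ps (int n)"

lemma q_nz: "q \<noteq> 0"
  using q by auto

lemma q_power_neq_1: "q ^ Suc k \<noteq> 1"
  using q by (metis norm_one norm_power power_Suc_less_one less_irrefl)

text \<open>The \<open>e1\<close>, ..., \<open>e4\<close> are elementary symmetric functions of the
  parameters; the fifth equals a^2 q / X by balancing. Since bcdef times \<open>T u\<close> is the
  product of all p - u, the coefficients of \<open>T\<close> are, up to sign and scaling, those of
  \<open>R\<close> in reverse order.\<close>

lemma symmetric_functions:
  obtains e1 e2 e3 e4 where
    "\<And>t. X * R t = X * (1 - e1 * t + e2 * t^2 - e3 * t^3 + e4 * t^4) - a^2 * q * t^5"
    "\<And>u. a^2 * q * T u = a^2 * q - X * (e4 * u - e3 * u^2 + e2 * u^3 - e1 * u^4 + u^5)"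
proof -
  obtain b c d e f where ps: "ps = [b, c, d, e, f]"
    using length_ps by (auto simp: length_Suc_conv eval_nat_numeral)
  have nz: "b \<noteq> 0" "c \<noteq> 0" "d \<noteq> 0" "e \<noteq> 0" "f \<noteq> 0"
    using ps_nz ps by auto
  have bal: "X * (b * c * d * e * f) = a^2 * q"
    using balanced ps by (simp add: mult.assoc)
  define e1 where "e1 = b + c + d + e + f"
  define e2 where "e2 = b*c + b*d + b*e + b*f + c*d + c*e + c*f + d*e + d*f + e*f"
  define e3 where "e3 = b*c*d + b*c*e + b*c*f + b*d*e + b*d*f + b*e*f + c*d*e + c*d*f + c*e*f + d*e*f"
  define e4 where "e4 = b*c*d*e + b*c*d*f + b*c*e*f + b*d*e*f + c*d*e*f"
  have R: "X * R t = X * (1 - e1 * t + e2 * t^2 - e3 * t^3 + e4 * t^4) - a^2 * q * t^5" for t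
    unfolding bal[symmetric] R_def e1_def e2_def e3_def e4_def unfolding ps by simp algebra
  have T_prod: "b * c * d * e * f * T u = (b - u) * (c - u) * (d - u) * (e - u) * (f - u)" for u
    unfolding T_def unfolding ps using nz by (simp add: field_simps)
  have T: "a^2 * q * T u = a^2 * q - X * (e4 * u - e3 * u^2 + e2 * u^3 - e1 * u^4 + u^5)" for u
    using T_prod[of u] unfolding bal[symmetric] e1_def e2_def e3_def e4_def by algebra
  from that[OF R T] show thesis .
qed

section \<open>Summands, certificate and common factor\<close>

text \<open>The product of (p)_n over all parameters p, grouped by powers of q so that a shift of n
  changes it by a single value of \<open>R\<close>. \<open>T_prod\<close> does the same for (a
  q^(n+1)/p)_k.\<close>

definition R_prod :: "nat \<Rightarrow> complex" where
  "R_prod n = (\<Prod>j<n. R (q^j))"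

definition T_prod :: "nat \<Rightarrow> nat \<Rightarrow> complex" where
  "T_prod n k = (\<Prod>j<k. T (a * q^(n + 1 + j)))"

lemma R_prod_0 [simp]: "R_prod 0 = 1" and R_prod_Suc: "R_prod (Suc n) = R_prod n * R (q^n)"
  by (simp_all add: R_prod_def)

lemma T_prod_0 [simp]: "T_prod n 0 = 1"
  and T_prod_Suc: "T_prod n (Suc k) = T_prod n k * T (a * q^(n + 1 + k))"
  by (simp_all add: T_prod_def)

lemma T_prod_Suc_shift: "T_prod n (Suc k) = T (a * q^(n + 1)) * T_prod (Suc n) k"
  unfolding T_prod_def prod.lessThan_Suc_shift by simp

definition Y_term :: "nat \<Rightarrow> nat \<Rightarrow> complex" where
  "Y_term n k = (1 / (q*X))^(n + 1) * (1 - a*q*(q^(n + k))^2) * q^k *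
     qpoch q (a*q) (2*n + k) * qpoch q (q^(n + 1)) k * qpoch q (1/X) k * T_prod n k /
     (qpoch q q k * qpoch q (a*q) (n + k) * qpoch q (a*X*q^(2*n + 2)) k * R_prod (n + k + 1))"

definition H :: "nat \<Rightarrow> nat \<Rightarrow> complex" where
  "H n k = (1 / (q*X))^n * (1 - 1/(q*X)) * qpoch q (1/X) k *
     qpoch q (a*q) (2*n + k) * qpoch q (q^(n + 1)) (k + 1) * T_prod n (k + 1) /
     (qpoch q q (k + 1) * qpoch q (a*q) (n + k) * qpoch q (a*X*q^(2*n + 2)) (k + 1) *
      R_prod (n + k + 1))"

text \<open>Chosen so that the quotients by it of all five quantities in the telescoping step are
  rational in y = q^n and Q = q^(j+1), with denominators free of Q.\<close>

definition common :: "nat \<Rightarrow> nat \<Rightarrow> complex" where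
  "common n j = (1 / (q*X))^(n + 2) * qpoch q (1/X) j *
     qpoch q (a*q) (2*n + j) * qpoch q (q^(n + 1)) (j + 1) * T_prod n (j + 1) /
     (qpoch q q (j + 2) * qpoch q (a*X*q^(2*n + 2)) (j + 2) * qpoch q (a*q) (n + j + 1) *
      R_prod (n + j + 2))"

lemma R_power_nz: "j \<le> N \<Longrightarrow> R (q^j) \<noteq> 0"
  using p_denom by (auto simp: R_def prod_list_zero_iff)

lemma R_prod_nz: "n \<le> N + 1 \<Longrightarrow> R_prod n \<noteq> 0"
  using R_power_nz by (auto simp: R_prod_def)

lemma qpoch_q_nz: "qpoch q q k \<noteq> 0"
  using q_power_neq_1 by (auto simp: qpoch_eq_0_iff)

lemma qpoch_aq_nz: "k \<le> N + 1 \<Longrightarrow> qpoch q (a*q) k \<noteq> 0"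
  using a_denom by (auto simp: qpoch_eq_0_iff)

lemma qpoch_aX_nz: "m + k \<le> 2*N + 3 \<Longrightarrow> qpoch q (a*X*q^m) k \<noteq> 0"
  using aX_denom[of "m + j" for j] by (auto simp: qpoch_eq_0_iff power_add mult.assoc)

section \<open>Quotients of the summands and of the certificate by the common factor\<close>

lemma Y_term_common:
  assumes "n + j + 1 \<le> N"
  defines "y \<equiv> q^n" and "Q \<equiv> q^(j + 1)"
  shows "Y_term n (j + 1) = common n j * ((1 - a*q*y^2*Q^2) * (1 - a*y^2*Q) * (q*X - Q) * Q *
           (1 - q*Q) * (1 - a*q^2*X*y^2*Q))"
proof -
  have 1: "qpoch q (a*q) (2*n + (j + 1)) = qpoch q (a*q) (2*n + j) * (1 - a*y^2*Q)"
    by (simp add: qpoch_Suc y_def Q_def power_add power_mult power2_eq_square power_mult_distrib mult_ac)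
  have 2: "qpoch q (1/X) (j + 1) = qpoch q (1/X) j * ((q*X - Q) / (q*X))"
    using q_nz X_nz by (simp add: qpoch_Suc Q_def diff_divide_distrib)
  have 3: "qpoch q q (j + 2) = qpoch q q (j + 1) * (1 - q*Q)"
    by (simp add: qpoch_Suc Q_def)
  have 4: "qpoch q (a*X*q^(2*n + 2)) (j + 2) =
      qpoch q (a*X*q^(2*n + 2)) (j + 1) * (1 - a*q^2*X*y^2*Q)"
    by (simp add: qpoch_Suc[of _ _ "Suc j"] y_def Q_def power_add power_mult power2_eq_square
        power_mult_distrib mult_ac)
  have 5: "(q^(n + (j + 1)))^2 = y^2 * Q^2"
    by (simp add: y_def Q_def power_add power_mult_distrib)
  have nz: "1 - q*Q \<noteq> 0" "1 - a*q^2*X*y^2*Q \<noteq> 0"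
    using qpoch_q_nz[of "j + 2"] qpoch_aX_nz[of "2*n + 2" "j + 2"] assms(1) unfolding 3 4 by auto
  show ?thesis
    unfolding Y_term_def common_def 1 2 3 4 5 Q_def[symmetric] using nz q_nz X_nz
    by (simp add: divide_simps power_add)
qed

lemma Y_term_Suc_common:
  assumes "Suc n + j + 1 \<le> N"
  defines "y \<equiv> q^Suc n" and "Q \<equiv> q^(j + 1)"
  shows "Y_term n (j + 2) = common (Suc n) j * (q^2 * (1 - a*q*y^2*Q^2) * (q*X - Q) * (X - Q) *
           (1 - y) * T (a*y) * Q * (1 - a*q*X*y^2*Q) * (1 - a*q^2*X*y^2*Q) /
           ((1 - a*X*y^2) * (1 - a*q*X*y^2)))"
proof -
  have 1: "qpoch q (q^(n + 1)) (j + 2) = (1 - y) * qpoch q (q^(Suc n + 1)) (j + 1)"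
    using qpoch_Suc_shift[of q y "j + 1"] by (simp add: y_def mult_ac)
  have 2: "qpoch q (1/X) (j + 2) = qpoch q (1/X) j * ((q*X - Q) / (q*X)) * ((X - Q) / X)"
    using q_nz X_nz by (simp add: qpoch_Suc Q_def diff_divide_distrib)
  have 3: "T_prod n (j + 2) = T (a*y) * T_prod (Suc n) (j + 1)"
    using T_prod_Suc_shift[of n "j + 1"] by (simp add: y_def)
  \<comment> \<open>Splitting two factors off the front and off the back of the same product relates
    the factorials with bases a X q^(2n+2) and a X q^(2n+4).\<close>
  have "qpoch q (a*X*y^2) (Suc (Suc (j + 2))) =
      (1 - a*X*y^2) * (1 - a*q*X*y^2) * qpoch q (a*X*q^(2*Suc n + 2)) (j + 2)"
    unfolding qpoch_Suc_shift
    by (simp add: y_def power_add power_mult power2_eq_square power_mult_distrib mult_ac)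
  moreover have "qpoch q (a*X*y^2) (Suc (Suc (j + 2))) =
      qpoch q (a*X*y^2) (j + 2) * (1 - a*q*X*y^2*Q) * (1 - a*q^2*X*y^2*Q)"
    unfolding qpoch_Suc by (simp add: Q_def power2_eq_square mult_ac)
  moreover have y2: "q^(2*n + 2) = y^2"
    by (simp add: y_def power_mult power_mult_distrib power2_eq_square)
  ultimately have 4: "(1 - a*X*y^2) * (1 - a*q*X*y^2) * qpoch q (a*X*q^(2*Suc n + 2)) (j + 2) =
      qpoch q (a*X*q^(2*n + 2)) (j + 2) * (1 - a*q*X*y^2*Q) * (1 - a*q^2*X*y^2*Q)"
    by simp
  have nz: "1 - a*X*y^2 \<noteq> 0" "1 - a*q*X*y^2 \<noteq> 0"
      "qpoch q (a*X*q^(2*Suc n + 2)) (j + 2) \<noteq> 0" "qpoch q (a*X*q^(2*n + 2)) (j + 2) \<noteq> 0"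
    using aX_denom[of "2*n + 2"] aX_denom[of "2*n + 3"] qpoch_aX_nz[of "2*Suc n + 2" "j + 2"]
      qpoch_aX_nz[of "2*n + 2" "j + 2"] assms(1)
    unfolding y2[symmetric] by (auto simp: power_add eval_nat_numeral mult_ac)
  have 6: "(q^(n + (j + 2)))^2 = y^2 * Q^2"
    by (simp add: y_def Q_def power_add power_mult_distrib mult_ac power2_eq_square)
  have 7: "1 / qpoch q (a*X*q^(2*n + 2)) (j + 2) =
     (1 - a*q*X*y^2*Q) * (1 - a*q^2*X*y^2*Q) /
     ((1 - a*X*y^2) * (1 - a*q*X*y^2) * qpoch q (a*X*q^(2*Suc n + 2)) (j + 2))"
  proof -
    have "1 - a*q*X*y^2*Q \<noteq> 0" "1 - a*q^2*X*y^2*Q \<noteq> 0"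
      using 4 nz by (metis mult_zero_left mult_zero_right mult_eq_0_iff)+
    then show ?thesis
      unfolding 4 using nz by simp
  qed
  have *: "Y_term n (j + 2) = (1 / (q*X))^(n + 1) * (1 - a*q*(y^2 * Q^2)) * q^(j + 2) *
     qpoch q (a*q) (2*Suc n + j) * ((1 - y) * qpoch q (q^(Suc n + 1)) (j + 1)) *
     (qpoch q (1/X) j * ((q*X - Q) / (q*X)) * ((X - Q) / X)) * (T (a*y) * T_prod (Suc n) (j + 1)) /
     (qpoch q q (j + 2) * qpoch q (a*q) (Suc n + j + 1) * R_prod (Suc n + j + 2)) *
     (1 / qpoch q (a*X*q^(2*n + 2)) (j + 2))"
    unfolding Y_term_def 1 2 3 6 by simp
  show ?thesis
    unfolding * 7 common_def using nz q_nz X_nz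
    by (simp add: divide_simps power2_eq_square Q_def)
qed

lemma beta_Y_term_common:
  assumes "n + j + 1 \<le> N"
  defines "y \<equiv> q^n" and "Q \<equiv> q^(j + 1)"
  shows "\<beta> (Suc n) * Y_term (Suc n) j = common n j * (R (q*X*y) * (1 - a*q*X*y) * (1 - a*y^2*Q) *
           (1 - a*q*y^2*Q) * Q * (1 - Q) * (1 - q*Q) * (1 - a*q*y^2*Q^2) /
           ((1 - a*q*X*y^2) * (1 - a*q^2*X*y^2)))"
proof -
  have 1: "qpoch q (q^(n + 1)) (j + 1) = (1 - q*y) * qpoch q (q^(Suc n + 1)) j"
    using qpoch_Suc_shift[of q "q*y" j] by (simp add: y_def mult_ac)
  have 2: "T_prod n (j + 1) = T (a*q*y) * T_prod (Suc n) j"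
    using T_prod_Suc_shift[of n j] by (simp add: y_def mult_ac)
  have 3: "qpoch q q (j + 2) = qpoch q q j * (1 - Q) * (1 - q*Q)"
    by (simp add: qpoch_Suc Q_def)
  have "qpoch q (a*X*q^(2*n + 2)) (j + 2) = (1 - a*X*q^(2*n + 2)) * (1 - a*X*q^(2*n + 2)*q) *
      qpoch q (a*X*q^(2*n + 2)*q*q) j"
    using qpoch_Suc_shift[of q "a*X*q^(2*n + 2)" "Suc j"]
      qpoch_Suc_shift[of q "a*X*q^(2*n + 2)*q" j] by simp
  moreover have "q^(2*n + 2) = q^2 * y^2" "q^(2*Suc n + 2) = q^2 * y^2 * q * q"
    by (simp_all add: y_def power_mult power2_eq_square power_mult_distrib)
  ultimately have 4: "qpoch q (a*X*q^(2*n + 2)) (j + 2) = (1 - a*q^2*X*y^2) * (1 - a*q^3*X*y^2) *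
      qpoch q (a*X*q^(2*Suc n + 2)) j"
    by (simp only:) (simp add: eval_nat_numeral mult_ac)
  have 5: "qpoch q (a*q) (2*Suc n + j) = qpoch q (a*q) (2*n + j) * (1 - a*y^2*Q) * (1 - a*q*y^2*Q)"
    by (simp add: qpoch_Suc y_def Q_def power_add power_mult power2_eq_square power_mult_distrib mult_ac)
  have 6: "(q^(Suc n + j))^2 = y^2 * Q^2"
    by (simp add: y_def Q_def power_add power_mult_distrib)
  have nz: "1 - a*q*X*y^2 \<noteq> 0" "1 - a*q^2*X*y^2 \<noteq> 0" "1 - a*q^3*X*y^2 \<noteq> 0" "1 - a*q*y \<noteq> 0"
      "1 - q*X*y \<noteq> 0"
    using aX_denom[of "2*n + 1"] aX_denom[of "2*n + 2"] aX_denom[of "2*n + 3"] a_denom[of n]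
      X_denom[of "Suc n"] assms(1)
    by (auto simp: y_def power_add power_mult eval_nat_numeral power_mult_distrib mult_ac)
  have nz': "1 - Q \<noteq> 0" "1 - q*Q \<noteq> 0"
    using qpoch_q_nz[of "j + 2"] unfolding 3 by auto
  \<comment> \<open>The factors 1 - q X y and 1 - a q y cancel between A_n and B_(n+1). The factors
    T(a q y) and 1 - q y that survive are the ones by which \<open>T_prod\<close> and
    (q^(n+1))_(j+1) change when n is raised.\<close>
  have beta: "\<beta> (Suc n) = (1 - a*q*X*y) * T (a*q*y) * q * (1 - q*y) * R (q*X*y) /
      ((1 - a*q^2*X*y^2) * (1 - a*q*X*y^2) * (1 - a*q^3*X*y^2) * (1 - a*q^2*X*y^2))"
  proof -
    have A: "coeff_A q a (a*q^2*X) ps (int (Suc n) - 1) = (1 - a*q*X*y) * (1 - q*X*y) * T (a*q*y) /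
        ((1 - a*q^2*X*y^2) * (1 - a*q*X*y^2) * (1 - a*q*y))"
      using coeff_A_nat[OF q_nz a_nz, of X ps n] by (simp add: y_def T_def)
    have B: "coeff_B q a (a*q^2*X) ps (int (Suc n)) =
        q * (1 - q*y) * (1 - a*q*y) * R (q*X*y) /
        ((1 - a*q^3*X*y^2) * (1 - a*q^2*X*y^2) * (1 - q*X*y))"
      unfolding coeff_B_nat[OF q_nz a_nz] R_def y_def
      by (simp add: power2_eq_square eval_nat_numeral mult_ac)
    show ?thesis
      unfolding coeff_b_def A B using nz by (simp add: divide_simps)
  qed
  show ?thesis
    unfolding beta Y_term_def common_def 1 2 3 4 5 6 using nz nz' q_nz X_nz
    by (simp add: divide_simps Q_def)
qed

lemma H_Suc_common:
  fixes n j defines "y \<equiv> q^n" and "Q \<equiv> q^(j + 1)"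
  shows "H n (j + 1) = common n j *
    ((q*X - 1) * (q*X - Q) * (1 - a*y^2*Q) * (1 - q*y*Q) * T (a*q*y*Q))"
proof -
  have 1: "qpoch q (a*q) (2*n + (j + 1)) = qpoch q (a*q) (2*n + j) * (1 - a*y^2*Q)"
    by (simp add: qpoch_Suc y_def Q_def power_add power_mult power2_eq_square power_mult_distrib mult_ac)
  have 2: "qpoch q (1/X) (j + 1) = qpoch q (1/X) j * ((q*X - Q) / (q*X))"
    using q_nz X_nz by (simp add: qpoch_Suc Q_def diff_divide_distrib)
  have 3: "qpoch q (q^(n + 1)) (j + 1 + 1) = qpoch q (q^(n + 1)) (j + 1) * (1 - q*y*Q)"
    by (simp add: qpoch_Suc y_def Q_def mult_ac)
  have 4: "T_prod n (j + 1 + 1) = T_prod n (j + 1) * T (a*q*y*Q)"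
    by (simp add: T_prod_Suc y_def Q_def power_add mult_ac)
  have 5: "1 - 1 / (q*X) = (q*X - 1) / (q*X)"
    using q_nz X_nz by (simp add: diff_divide_distrib)
  show ?thesis
    unfolding H_def common_def 1 2 3 4 5 using q_nz X_nz
    by (simp add: divide_simps)
qed

lemma H_common:
  assumes "n + j + 1 \<le> N"
  defines "y \<equiv> q^n" and "Q \<equiv> q^(j + 1)"
  shows "H n j = common n j *
    ((q*X - 1) * (q * X * (1 - q*Q) * (1 - a*q^2*X*y^2*Q) * (1 - a*y*Q) * R (y*Q)))"
proof -
  have 3: "qpoch q q (j + 2) = qpoch q q (j + 1) * (1 - q*Q)"
    by (simp add: qpoch_Suc Q_def)
  have 4: "qpoch q (a*X*q^(2*n + 2)) (j + 2) =
      qpoch q (a*X*q^(2*n + 2)) (j + 1) * (1 - a*q^2*X*y^2*Q)"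
    by (simp add: qpoch_Suc[of _ _ "Suc j"] y_def Q_def power_add power_mult power2_eq_square
        power_mult_distrib mult_ac)
  have 1: "qpoch q (a*q) (n + j + 1) = qpoch q (a*q) (n + j) * (1 - a*y*Q)"
    by (simp add: qpoch_Suc y_def Q_def power_add mult_ac)
  have 2: "R_prod (n + j + 2) = R_prod (n + j + 1) * R (y*Q)"
    by (simp add: R_prod_Suc y_def Q_def power_add mult_ac)
  have 5: "1 - 1 / (q*X) = (q*X - 1) / (q*X)"
    using q_nz X_nz by (simp add: diff_divide_distrib)
  \<comment> \<open>Each is the last factor of a nonzero product. The bound n + j + 1 <= N is
    exactly what \<open>R_prod (n + j + 2)\<close> requires.\<close>
  have nz: "1 - q*Q \<noteq> 0" "1 - a*q^2*X*y^2*Q \<noteq> 0" "1 - a*y*Q \<noteq> 0" "R (y*Q) \<noteq> 0"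
    using qpoch_q_nz[of "j + 2"] qpoch_aX_nz[of "2*n + 2" "j + 2"] qpoch_aq_nz[of "n + j + 1"]
      R_prod_nz[of "n + j + 2"] assms(1)
    unfolding 1 2 3 4 by auto
  show ?thesis
    unfolding H_def common_def 1 2 3 4 5 using nz q_nz X_nz
    by (simp add: divide_simps)
qed

text \<open>\<open>Y_prev_term n\<close> is the sequence of terms with index \<open>n - 1\<close>. For \<open>n = 0\<close> the factor
  \<open>(q\<^sup>0)\<^sub>k\<close> cuts the series down to its first term.\<close>

definition Y_prev_term :: "nat \<Rightarrow> nat \<Rightarrow> complex" where
  "Y_prev_term n k = (if n = 0 then if k = 0 then 1 else 0 else Y_term (n - 1) k)"

lemma Y_prev_term_common:
  assumes "n + j + 1 \<le> N"
  defines "y \<equiv> q^n" and "Q \<equiv> q^(j + 1)"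
  shows "Y_prev_term n (j + 2) = common n j * (q^2 * (1 - a*q*y^2*Q^2) * (q*X - Q) * (X - Q) *
           (1 - y) * T (a*y) * Q * (1 - a*q*X*y^2*Q) * (1 - a*q^2*X*y^2*Q) /
           ((1 - a*X*y^2) * (1 - a*q*X*y^2)))"
proof (cases n)
  case 0
  \<comment> \<open>Both sides are 0, the right one through its factor 1 - y.\<close>
  then show ?thesis by (simp add: Y_prev_term_def y_def)
next
  case (Suc m)
  then show ?thesis
    using Y_term_Suc_common[of m j] assms by (simp add: Y_prev_term_def)
qed

section \<open>The polynomial identity behind the recurrence\<close>

text \<open>The order is that of the premises of \<open>divide_clear_denominators\<close>.\<close>

lemma denoms_nz:
  assumes "n \<le> N"
  defines "y \<equiv> q^n"
  shows "1 - a*X*y^2 \<noteq> 0" "1 - a*q*X*y^2 \<noteq> 0" "1 - a*q^2*X*y^2 \<noteq> 0" "1 - a*q*y \<noteq> 0" "1 - X*y \<noteq> 0"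
  using aX_denom[of "2*n"] aX_denom[of "2*n + 1"] aX_denom[of "2*n + 2"] a_denom[of n] X_denom[of n]
    assms(1)
  by (auto simp: y_def power_add power_mult eval_nat_numeral power_mult_distrib mult_ac)

lemma alpha_eq:
  fixes n defines "y \<equiv> q^n"
  shows "\<alpha> n = (1 - a*q*X*y) * (1 - q*X*y) * T (a*q*y) /
      ((1 - a*q^2*X*y^2) * (1 - a*q*X*y^2) * (1 - a*q*y)) +
    q * (1 - y) * (1 - a*y) * R (X*y) / ((1 - a*q*X*y^2) * (1 - a*X*y^2) * (1 - X*y)) +
    q*X*y^2 * (1 - X) * R 1 / ((1 - a*q*y) * (1 - X*y))"
  unfolding coeff_a_nat[OF q_nz a_nz] coeff_A_nat[OF q_nz a_nz] coeff_B_nat[OF q_nz a_nz]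
  by (simp add: T_def R_def y_def)

text \<open>After division by the common factor, \<open>Q = q\<^sup>k\<close> is a free variable. Both sides are linear in the
  elementary symmetric functions of the parameters, the fifth of which is fixed by the balancing
  condition.\<close>

lemma core_identity:
  fixes Q :: complex
  assumes "n \<le> N"
  defines "y \<equiv> q^n"
  shows "q^2 * (1 - a*q*y^2*Q^2) * (q*X - Q) * (X - Q) * (1 - y) * T (a*y) * Q * (1 - a*q*X*y^2*Q) *
        (1 - a*q^2*X*y^2*Q) / ((1 - a*X*y^2) * (1 - a*q*X*y^2)) -
      \<alpha> n * ((1 - a*q*y^2*Q^2) * (1 - a*y^2*Q) * (q*X - Q) * Q * (1 - q*Q) * (1 - a*q^2*X*y^2*Q)) +
      R (q*X*y) * (1 - a*q*X*y) * (1 - a*y^2*Q) * (1 - a*q*y^2*Q) * Q * (1 - Q) * (1 - q*Q) *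
        (1 - a*q*y^2*Q^2) / ((1 - a*q*X*y^2) * (1 - a*q^2*X*y^2)) =
    (q*X - 1) * (q*X - Q) * (1 - a*y^2*Q) * (1 - q*y*Q) * T (a*q*y*Q) -
    (q*X - 1) * (q*X * (1 - q*Q) * (1 - a*q^2*X*y^2*Q) * (1 - a*y*Q) * R (y*Q))"
proof -
  obtain e1 e2 e3 e4 where
    R: "\<And>t. X * R t = X * (1 - e1 * t + e2 * t^2 - e3 * t^3 + e4 * t^4) - a^2 * q * t^5" and
    T: "\<And>u. a^2 * q * T u = a^2 * q - X * (e4 * u - e3 * u^2 + e2 * u^3 - e1 * u^4 + u^5)"
    using symmetric_functions by blast
  \<comment> \<open>Every term of the identity contains exactly one value of \<open>R\<close> or
    \<open>T\<close>. Hence \<open>k\<close> is a factor of all terms, and \<open>algebra\<close>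
    may treat it as a free variable.\<close>
  define k where "k = 1 / (X * (a^2 * q))"
  have kR: "R t = k * (a^2 * q * (X * (1 - e1 * t + e2 * t^2 - e3 * t^3 + e4 * t^4) - a^2 * q * t^5))" for t
    unfolding R[symmetric] k_def using a_nz q_nz X_nz by simp
  have kR_1: "R 1 = k * (a^2 * q * (X * (1 - e1 + e2 - e3 + e4) - a^2 * q))"
    using kR[of 1] by simp
  have kT: "T u = k * (X * (a^2 * q - X * (e4 * u - e3 * u^2 + e2 * u^3 - e1 * u^4 + u^5)))" for u
    unfolding T[symmetric] k_def using a_nz q_nz X_nz by simp
  show ?thesis
    unfolding alpha_eq[of n, folded y_def]
    apply (rule divide_clear_denominators[OF denoms_nz[OF assms(1), folded y_def]])
    unfolding kR_1 unfolding kR kT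
    by algebra
qed

section \<open>Telescoping\<close>

text \<open>This is \<open>core_identity\<close> at Q = q^(j+1), multiplied by
  \<open>common n j\<close>.\<close>

lemma telescoping_step:
  assumes "n + j + 1 \<le> N"
  shows "Y_prev_term n (j + 2) - \<alpha> n * Y_term n (j + 1) + \<beta> (Suc n) * Y_term (Suc n) j =
    H n (j + 1) - H n j"
proof -
  have mult_distrib: "c * t1 - u * (c * t2) + c * t3 = c * h1 - c * h2"
    if "t1 - u * t2 + t3 = h1 - h2" for c t1 t2 t3 h1 h2 u :: complex
    using that by algebra
  have "n \<le> N"
    using assms by simp
  from mult_distrib[OF core_identity[OF this]] show ?thesis
    unfolding Y_prev_term_common[OF assms] Y_term_common[OF assms] beta_Y_term_common[OF assms]
      H_Suc_common H_common[OF assms] .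
qed

text \<open>Formally the telescoping step with j = -1, that is, \<open>core_identity\<close> at Q =
  1. The \<beta> summand vanishes through 1 - Q, and the other summands share the factor q X - 1.
  Once this is cancelled, the summand belonging to H at index -1 turns into the first term of
  Y_m.\<close>

lemma telescoping_start_Suc:
  assumes "Suc m \<le> N"
  shows "Y_term m 0 + Y_term m 1 - \<alpha> (Suc m) * Y_term (Suc m) 0 = H (Suc m) 0"
proof -
  define y where "y = q^Suc m"
  \<comment> \<open>The formal value of \<open>common (Suc m)\<close> at index -1, multiplied by q X
    - 1, where (1/X)_(-1) = q X / (q X - 1).\<close>
  define C where "C = (1 / (q*X))^(m + 2) * qpoch q (a*q) (2*m + 1) /
    ((1 - q) * qpoch q (a*q) (Suc m) * R_prod (m + 2) * (1 - a*q^2*X*y^2))"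
  have D: "1 - q \<noteq> 0"
    using q_power_neq_1[of 0] by simp
  note nz = denoms_nz[OF assms, folded y_def]
  have pows: "q^(2*m + 2) = y^2" "q^(2*Suc m + 2) = q^2*y^2" "q^(Suc m) = y" "q^(Suc m + 1) = q*y"
    by (simp_all add: y_def power_mult power2_eq_square power_mult_distrib)
  have 1: "qpoch q (a*q) (2*m + 1) = qpoch q (a*q) (2*m) * (1 - a*q*(q^m)^2)"
    by (simp add: qpoch_Suc power_mult power2_eq_square power_mult_distrib)
  have 2: "qpoch q (a*q) (2*Suc m) = qpoch q (a*q) (2*m + 1) * (1 - a*y^2)"
    by (simp add: qpoch_Suc y_def power_mult power2_eq_square power_mult_distrib mult_ac)
  have 3: "qpoch q (a*q) (Suc m) = qpoch q (a*q) m * (1 - a*y)"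
    by (simp add: qpoch_Suc y_def mult_ac)
  have 4: "R_prod (m + 2) = R_prod (m + 1) * R y"
    by (simp add: R_prod_Suc y_def)
  have 5: "qpoch q (a*q) (Suc m) \<noteq> 0" "R_prod (m + 2) \<noteq> 0"
    using qpoch_aq_nz[of "Suc m"] R_prod_nz[of "m + 2"] assms by auto
  have qp1: "qpoch q x (Suc 0) = 1 - x" for x
    by (simp add: qpoch_def)
  have A: "Y_term m 0 = C * (q*X * (1 - q) * (1 - a*q^2*X*y^2) * (1 - a*y) * R y)"
    using 5 nz D q_nz X_nz unfolding Y_term_def C_def 1 3 4 by (simp add: divide_simps)
  have B: "Y_term m 1 = C * (q^2 * (1 - a*q*y^2) * (1 - y) * (X - 1) * T (a*y) *
      (1 - a*q^2*X*y^2) / (1 - a*X*y^2))"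
  proof -
    have "1 - 1 / X = (X - 1) / X"
      using X_nz by (simp add: diff_divide_distrib)
    moreover have "q * q^m = y"
      by (simp add: y_def)
    ultimately show ?thesis
      using 5 nz D q_nz X_nz unfolding Y_term_def C_def pows T_prod_def
      by (simp add: qp1 divide_simps power2_eq_square)
  qed
  have C: "Y_term (Suc m) 0 = C * ((1 - a*q*y^2) * (1 - a*y^2) * (1 - q) * (1 - a*q^2*X*y^2))"
    using 5 nz D q_nz X_nz unfolding Y_term_def C_def add_0_right pows 2 by (simp add: divide_simps)
  have D: "H (Suc m) 0 = C * ((q*X - 1) * (1 - a*y^2) * (1 - q*y) * T (a*q*y))"
  proof -
    have "1 - 1 / (q*X) = (q*X - 1) / (q*X)"
      using q_nz X_nz by (simp add: diff_divide_distrib)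
    moreover have "q * q^m = y"
      by (simp add: y_def)
    ultimately show ?thesis
      using 5 nz D q_nz X_nz unfolding H_def C_def add_0_right pows 2 T_prod_def
      by (simp add: qp1 divide_simps mult_ac)
  qed
  define t1 where "t1 = q^2 * (1 - a*q*y^2) * (1 - y) * (X - 1) * T (a*y) * (1 - a*q^2*X*y^2) / (1 - a*X*y^2)"
  have t1: "q^2 * (1 - a*q*y^2*1^2) * (q*X - 1) * (X - 1) * (1 - y) * T (a*y) * 1 * (1 - a*q*X*y^2*1) *
        (1 - a*q^2*X*y^2*1) / ((1 - a*X*y^2) * (1 - a*q*X*y^2)) = (q*X - 1) * t1"
    using nz(1,2) unfolding t1_def by (simp add: divide_simps)
  have "q*X - 1 \<noteq> 0"
    using X_denom[of 1] assms by (simp add: mult.commute)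
  moreover have "(q*X - 1) * (q*X * (1 - q) * (1 - a*q^2*X*y^2) * (1 - a*y) * R y + t1 -
      \<alpha> (Suc m) * ((1 - a*q*y^2) * (1 - a*y^2) * (1 - q) * (1 - a*q^2*X*y^2))) =
    (q*X - 1) * ((q*X - 1) * (1 - a*y^2) * (1 - q*y) * T (a*q*y))"
  proof -
    have "(q*X - 1) * t1 -
        \<alpha> (Suc m) * ((1 - a*q*y^2) * (1 - a*y^2) * (q*X - 1) * (1 - q) * (1 - a*q^2*X*y^2)) =
      (q*X - 1) * (q*X - 1) * (1 - a*y^2) * (1 - q*y) * T (a*q*y) -
      (q*X - 1) * (q*X * (1 - q) * (1 - a*q^2*X*y^2) * (1 - a*y) * R y)"
      using core_identity[OF assms, of 1, folded y_def, unfolded t1] by simp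
    then show ?thesis
      by algebra
  qed
  ultimately have key: "q*X * (1 - q) * (1 - a*q^2*X*y^2) * (1 - a*y) * R y + t1 -
      \<alpha> (Suc m) * ((1 - a*q*y^2) * (1 - a*y^2) * (1 - q) * (1 - a*q^2*X*y^2)) =
    (q*X - 1) * (1 - a*y^2) * (1 - q*y) * T (a*q*y)"
    by (meson mult_left_cancel)
  have "c * u + c * v - w * (c * x) = c * (u + v - w * x)" for c u v w x :: complex
    by algebra
  then show ?thesis
    unfolding A B[folded t1_def] C D key[symmetric] .
qed

lemma telescoping_start_0: "1 - \<alpha> 0 * Y_term 0 0 = H 0 0"
proof -
  have 0: "1 - a*q*X \<noteq> 0" "1 - a*q^2*X \<noteq> 0" "1 - a*q \<noteq> 0" "1 - X \<noteq> 0" "1 - q \<noteq> 0" "R 1 \<noteq> 0"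
    using denoms_nz[of 0] q_power_neq_1[of 0] R_power_nz[of 0] by auto
  have 1: "\<alpha> 0 = ((1 - q*X) * T (a*q) / (1 - a*q^2*X) + q*X * R 1) / (1 - a*q)"
  proof -
    have "\<alpha> 0 = (1 - a*q*X) * (1 - q*X) * T (a*q) / ((1 - a*q^2*X) * (1 - a*q*X) * (1 - a*q)) +
        q*X * (1 - X) * R 1 / ((1 - a*q) * (1 - X))"
      unfolding alpha_eq by simp
    moreover have "u * v * w / (x * u * y) + z * t * r / (y * t) = (v * w / x + z * r) / y"
      if "u \<noteq> 0" "t \<noteq> 0" for u v w x y z t r :: complex
      using that by (simp add: add_divide_distrib)
    ultimately show ?thesis
      using 0 by (simp only: not_False_eq_True)
  qed
  have 2: "Y_term 0 0 = (1 - a*q) / (q*X * R 1)"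
    by (simp add: Y_term_def R_prod_def)
  have 3: "H 0 0 = (1 - 1/(q*X)) * T (a*q) / ((1 - a*q^2*X) * R 1)"
    using 0 by (simp add: H_def R_prod_def T_prod_def qpoch_def power2_eq_square mult_ac)
  have "1 - ((1 - g) * t / u + g * r) / v * (v / (g * r)) = (1 - 1 / g) * t / (u * r)"
    if "g \<noteq> 0" "r \<noteq> 0" "u \<noteq> 0" "v \<noteq> 0" for g r t u v :: complex
    using that by (simp add: field_simps)
  then show ?thesis
    unfolding 1 2 3 using 0 q_nz X_nz by simp
qed

text \<open>The three ranges differ in length because each step pairs index k + 2 of Y_(n-1) with k
  + 1 of Y_n and k of Y_(n+1). The terms left over at M = 0 are those of the two starting
  identities.\<close>

lemma telescoping_sum:
  assumes "n + M \<le> N"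
  shows "(\<Sum>k<M + 2. Y_prev_term n k) - \<alpha> n * (\<Sum>k<M + 1. Y_term n k) +
    \<beta> (Suc n) * (\<Sum>k<M. Y_term (Suc n) k) = H n M"
  using assms
proof (induction M)
  case 0
  then show ?case
    using telescoping_start_0 telescoping_start_Suc[of "n - 1"]
    by (cases n) (simp_all add: Y_prev_term_def numeral_2_eq_2)
next
  case (Suc M)
  have combine: "s1 + t1 - u * (s2 + t2) + v * (s3 + t3) = h'"
    if "s1 - u * s2 + v * s3 = h" "t1 - u * t2 + v * t3 = h' - h"
    for s1 s2 s3 t1 t2 t3 u v h h' :: complex
  proof -
    have "h' = (s1 - u * s2 + v * s3) + (t1 - u * t2 + v * t3)"
      unfolding that by simp
    then show ?thesis
      by (simp add: algebra_simps)
  qed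
  have sums: "(\<Sum>k<M + 1 + 2. Y_prev_term n k) = (\<Sum>k<M + 2. Y_prev_term n k) + Y_prev_term n (M + 2)"
    "(\<Sum>k<M + 1 + 1. Y_term n k) = (\<Sum>k<M + 1. Y_term n k) + Y_term n (M + 1)"
    "(\<Sum>k<M + 1. Y_term (Suc n) k) = (\<Sum>k<M. Y_term (Suc n) k) + Y_term (Suc n) M"
    by simp_all
  have "n + M \<le> N" "n + M + 1 \<le> N"
    using Suc.prems by auto
  from combine[OF Suc.IH[OF this(1)] telescoping_step[OF this(2)]] show ?case
    unfolding Suc_eq_plus1[of M] sums .
qed

section \<open>The recurrence and the tails of the continued fraction\<close>

text \<open>The truncation is exact for \<open>n \<le> N\<close>, because the omitted terms vanish; \<open>Y (N + 1) = 0\<close>.\<close>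

definition Y :: "nat \<Rightarrow> complex" where
  "Y n = (\<Sum>k<N + 1 - n. Y_term n k)"

text \<open>The terminating parameter p = a q^(N+1) contributes the factor 1 - 1. This value of
  \<open>T\<close> ends the series and kills the boundary term of the telescoping.\<close>

lemma T_last: "T (a * q^(N + 1)) = 0"
  using terminating ps_nz by (auto simp: T_def prod_list_zero_iff mult.assoc image_iff)

lemma H_last: "n \<le> N \<Longrightarrow> H n (N - n) = 0"
proof -
  assume "n \<le> N"
  then have "T_prod n (N - n + 1) = 0"
    using T_last by (simp add: T_prod_Suc)
  then show ?thesis
    by (simp add: H_def)
qed

text \<open>At M = N - n the ranges in \<open>telescoping_sum\<close> are precisely those of
  \<open>Y (n - 1)\<close>, \<open>Y n\<close> and \<open>Y (Suc n)\<close>, and the boundary term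
  is 0 by \<open>H_last\<close>.\<close>

lemma recurrence:
  assumes "n \<le> N"
  shows "(if n = 0 then 1 else Y (n - 1)) = \<alpha> n * Y n - \<beta> (Suc n) * Y (Suc n)"
proof -
  have "(\<Sum>k<N - n + 2. Y_prev_term n k) = (if n = 0 then 1 else Y (n - 1))"
  proof (cases n)
    case 0
    then show ?thesis
      by (simp add: Y_prev_term_def sum.If_cases lessThan_Suc_eq_insert_0 del: sum.lessThan_Suc)
  next
    case (Suc m)
    then have "N - n + 2 = N + 1 - m"
      using assms by simp
    then show ?thesis
      using Suc by (simp add: Y_prev_term_def Y_def)
  qed
  moreover have "N - n + 1 = N + 1 - n"
    using assms by simp
  ultimately show ?thesis
    using telescoping_sum[of n "N - n"] H_last[OF assms] assms
    by (simp add: Y_def algebra_simps del: sum.lessThan_Suc)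
qed

text \<open>Induction from the innermost level n = N, where \<open>Y (N + 1)\<close> is an empty sum
  and the recurrence has only two terms. The product form avoids dividing by
  \<open>Y n\<close>.\<close>

lemma cf_tail_Y:
  assumes "\<And>n. n \<le> N \<Longrightarrow> cf_tail \<alpha> \<beta> n (N - n) \<noteq> 0" and "n + m = N"
  shows "cf_tail \<alpha> \<beta> n m * Y n = (if n = 0 then 1 else Y (n - 1))"
  using assms(2)
proof (induction m arbitrary: n)
  case 0
  then show ?case
    using recurrence[of n] by (simp add: Y_def)
next
  case (Suc m)
  have "cf_tail \<alpha> \<beta> (Suc n) m * Y (Suc n) = Y n"
    using Suc.IH[of "Suc n"] Suc.prems by simp
  moreover have "cf_tail \<alpha> \<beta> (Suc n) m \<noteq> 0"
    using assms(1)[of "Suc n"] Suc.prems by (metis add_Suc_shift diff_add_inverse le_add1)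
  ultimately have "Y n / cf_tail \<alpha> \<beta> (Suc n) m = Y (Suc n)"
    by (simp add: field_simps)
  moreover have "cf_tail \<alpha> \<beta> n (Suc m) * Y n =
      \<alpha> n * Y n - \<beta> (Suc n) * (Y n / cf_tail \<alpha> \<beta> (Suc n) m)"
    by (simp add: left_diff_distrib)
  ultimately show ?case
    using recurrence[of n] Suc.prems by simp
qed

section \<open>Identification of Y_0 with the very-well-poised series\<close>

lemma Y_0: "Y 0 = 1 / (q*X) * ((1 - a*q) / R 1) *
  vwp_series q (a*q) (q # 1 / X # map (\<lambda>p. a*q / p) ps)"
proof -
  define t where "t k = (1 - a*q * q^(2*k)) / (1 - a*q) *
      (qpoch q (a*q) k * (\<Prod>p\<leftarrow>q # 1 / X # map (\<lambda>p. a*q / p) ps. qpoch q p k)) /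
      (qpoch q q k * (\<Prod>p\<leftarrow>q # 1 / X # map (\<lambda>p. a*q / p) ps. qpoch q (a*q * q / p) k)) * q^k" for k
  have numer: "(\<Prod>p\<leftarrow>map (\<lambda>p. a*q / p) ps. qpoch q p k) = T_prod 0 k" for k
  proof -
    have "(\<Prod>p\<leftarrow>map (\<lambda>p. a*q / p) xs. qpoch q p k) =
        (\<Prod>j<k. \<Prod>p\<leftarrow>xs. 1 - a * q^(0 + 1 + j) / p)" for xs
      by (induction xs) (simp_all add: qpoch_def prod.distrib mult_ac)
    then show ?thesis
      unfolding T_prod_def T_def .
  qed
  \<comment> \<open>The denominator parameter belonging to a q / p is p q, and (1 - p) (p q)_k =
    (p)_(k+1); \<open>R 1\<close> supplies the factors 1 - p.\<close>
  have denom: "R 1 * (\<Prod>p\<leftarrow>map (\<lambda>p. a*q / p) ps. qpoch q (a*q * q / p) k) = R_prod (k + 1)" for k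
  proof -
    have "(\<Prod>p\<leftarrow>map (\<lambda>p. a*q / p) xs. qpoch q (a*q * q / p) k) =
        (\<Prod>j<k. \<Prod>p\<leftarrow>xs. 1 - p * q^Suc j)" if "0 \<notin> set xs" for xs
      using that a_nz q_nz by (induction xs) (simp_all add: qpoch_def prod.distrib mult_ac)
    from this[OF ps_nz] show ?thesis
      unfolding R_prod_def R_def Suc_eq_plus1[symmetric] prod.lessThan_Suc_shift by simp
  qed
  have Y_term_t: "Y_term 0 k = 1 / (q*X) * ((1 - a*q) / R 1) * t k" if "k \<le> N" for k
  proof -
    define P where "P = (\<Prod>p\<leftarrow>map (\<lambda>p. a*q / p) ps. qpoch q (a*q * q / p) k)"
    have shifts: "a*q * q / q = a*q" "a*q * q / (1/X) = a*X*q^2"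
      using q_nz by (simp_all add: power2_eq_square mult_ac)
    have R_P: "R_prod (0 + k + 1) = R 1 * P"
      using denom[of k] by (simp add: P_def)
    have nz: "1 - a*q \<noteq> 0" "R 1 \<noteq> 0"
      using a_denom[of 0] R_power_nz[of 0] by auto
    have "t k = (1 - a*q * q^(2*k)) / (1 - a*q) *
      (qpoch q (a*q) k * (qpoch q q k * (qpoch q (1/X) k * T_prod 0 k))) /
      (qpoch q q k * (qpoch q (a*q) k * (qpoch q (a*X*q^2) k * P))) * q^k"
      unfolding t_def P_def list.map prod_list.Cons numer shifts by simp
    then show ?thesis
      unfolding Y_term_def R_P using nz by (simp add: power_mult power2_eq_square mult_ac)
  qed
  \<comment> \<open>Beyond N the numerator contains T(a q^(N+1)) = 0, so the term is 0 whatever its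
    denominator, and the infinite sum is finite.\<close>
  have "T_prod 0 k = 0" if "N < k" for k
    using that T_last by (auto simp: T_prod_def intro!: bexI[of _ N])
  then have "t k = 0" if "k \<notin> {..<N + 1}" for k
    using that unfolding t_def list.map prod_list.Cons numer by simp
  then have "vwp_series q (a*q) (q # 1 / X # map (\<lambda>p. a*q / p) ps) = (\<Sum>k<N + 1. t k)"
    unfolding vwp_series_def t_def[symmetric] by (intro suminf_finite) auto
  moreover have "Y 0 = (\<Sum>k<N + 1. 1 / (q*X) * ((1 - a*q) / R 1) * t k)"
    unfolding Y_def by (intro sum.cong) (auto simp: Y_term_t)
  ultimately show ?thesis
    by (simp only: sum_distrib_left)
qed

end

section \<open>Transfer to the original parameters\<close>

theorem corollary3p3:
  fixes q a b c d e f s :: complex and N :: nat and \<alpha> \<beta> :: "nat \<Rightarrow> complex"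
  assumes q: "0 < norm q" "norm q < 1"
    and nz: "a \<noteq> 0" "b \<noteq> 0" "c \<noteq> 0" "d \<noteq> 0" "e \<noteq> 0" "f \<noteq> 0"
    and s: "s = a ^ 3 * q ^ 3 / (b * c * d * e * f)"
    and term_cond: "\<exists>p \<in> {b, c, d, e, f}. a * q / p = q powi (- int N)"
    and \<alpha>: "\<alpha> = (\<lambda>n. coeff_a q a s [b, c, d, e, f] (int n))"
    and \<beta>: "\<beta> = (\<lambda>n. coeff_b q a s [b, c, d, e, f] (int n))"
    (* no zero denominators in the coefficients, ... *)
    and coeff_denoms: "\<And>n. n \<le> N \<Longrightarrow>
          1 - s * q powi (2 * int n) \<noteq> 0 \<and>
          1 - s * q powi (2 * int n - 1) \<noteq> 0 \<and>
          1 - s * q powi (2 * int n - 2) \<noteq> 0 \<and>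
          1 - a * q powi (int n + 1) \<noteq> 0 \<and>
          1 - s * q powi (int n - 2) / a \<noteq> 0"
    (* ... in the continued fraction, ... *)
    and cf_denoms: "\<And>n. n \<le> N \<Longrightarrow> cf_tail \<alpha> \<beta> n (N - n) \<noteq> 0"
    (* ... in the prefactor, and in the terms of the series that are not trivially zero *)
    and prefactor_denoms: "b \<noteq> 1" "c \<noteq> 1" "d \<noteq> 1" "e \<noteq> 1" "f \<noteq> 1"
    and series_denoms: "\<And>k p. k \<le> N \<Longrightarrow>
          p \<in> {q, a * q ^ 2 / s, a * q / b, a * q / c, a * q / d, a * q / e, a * q / f} \<Longrightarrow>
          qpoch q ((a * q) * q / p) k \<noteq> 0"
  shows "1 / cf_tail \<alpha> \<beta> 0 N =
    a * q / s * ((1 - a * q) / ((1 - b) * (1 - c) * (1 - d) * (1 - e) * (1 - f))) *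
    vwp_series q (a * q)
      [q, a * q ^ 2 / s, a * q / b, a * q / c, a * q / d, a * q / e, a * q / f]"
proof -
  define ps where "ps = [b, c, d, e, f]"
  define X where "X = s / (a * q^2)"
  have q_nz: "q \<noteq> 0"
    using q by auto
  have s_nz: "s \<noteq> 0"
    using nz q_nz by (simp add: s)
  have s_X: "s = a * q^2 * X"
    using nz q_nz by (simp add: X_def)
  have powi_minus_1: "q powi (2 * int n - 1) = q^(2*n) / q"
    and powi_minus_2: "q powi (2 * int n - 2) = q^(2*n) / q^2"
    and powi_even: "q powi (2 * int n) = q^(2*n)"
    and powi_pred2: "q powi (int n - 2) = q^n / q^2" for n
  proof -
    show *: "q powi (2 * int n) = q^(2*n)"
      by (metis of_nat_mult of_nat_numeral power_int_of_nat)
    show "q powi (2 * int n - 1) = q^(2*n) / q" "q powi (2 * int n - 2) = q^(2*n) / q^2"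
        "q powi (int n - 2) = q^n / q^2"
      using q_nz * by (simp_all add: power_int_diff)
  qed
  have aX_denom: "a*X*q^m \<noteq> 1" if "m \<le> 2*N + 2" for m
  proof -
    have eq: "a*X*q^m = s * q^m / q^2"
      using nz by (simp add: X_def)
    \<comment> \<open>The three cases come from the denominators 1 - s q^(2n-2) at n = 0, 1 - s
      q^(2n-1) and 1 - s q^(2n).\<close>
    consider "m = 0" | n where "n \<le> N" "m = 2*n + 1" | n where "n \<le> N" "m = 2*n + 2"
    proof (cases "even m")
      case True
      then obtain l where "m = 2*l" by blast
      then show thesis
        using that(1) that(3)[of "l - 1"] \<open>m \<le> 2*N + 2\<close> by (cases l) auto
    next
      case False
      then obtain l where "m = 2*l + 1" using oddE by blast
      then show thesis
        using that(2)[of l] \<open>m \<le> 2*N + 2\<close> by auto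
    qed
    then show ?thesis
    proof cases
      case 1
      then show ?thesis
        using coeff_denoms[of 0] unfolding eq powi_minus_2 by auto
    next
      case (2 n)
      then show ?thesis
        using coeff_denoms[of n] q_nz unfolding eq powi_minus_1 by (auto simp: power2_eq_square)
    next
      case (3 n)
      then show ?thesis
        using coeff_denoms[of n] q_nz unfolding eq powi_even by (auto simp: power2_eq_square)
    qed
  qed
  have a_denom: "a*q*q^n \<noteq> 1" and X_denom: "X*q^n \<noteq> 1" if "n \<le> N" for n
    using coeff_denoms[OF that] q_nz nz unfolding powi_pred2
    by (auto simp: power_int_add X_def mult_ac)
  have p_denom: "p*q^n \<noteq> 1" if "n \<le> N" "p \<in> set ps" for n p
  proof (cases n)
    case 0
    then show ?thesis
      using prefactor_denoms that by (auto simp: ps_def)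
  next
    case (Suc j)
    \<comment> \<open>For n = j + 1 the factor 1 - p q^n occurs in (p q)_N, the denominator that the
      series parameter a q / p produces at k = N.\<close>
    have "a*q / p \<in> {q, a * q ^ 2 / s, a*q / b, a*q / c, a*q / d, a*q / e, a*q / f}"
      using that(2) by (auto simp: ps_def)
    from series_denoms[OF order_refl this] have "qpoch q (a*q * q / (a*q / p)) N \<noteq> 0" .
    moreover have "a*q * q / (a*q / p) = p * q"
      using nz q_nz by simp
    ultimately show ?thesis
      using Suc that(1) by (auto simp: qpoch_eq_0_iff mult.assoc)
  qed
  have terminating: "\<exists>p\<in>set ps. a*q*q^N = p"
  proof -
    obtain p where p: "p \<in> set ps" "a * q / p = q powi (- int N)"
      using term_cond by (auto simp: ps_def)
    have "p \<noteq> 0"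
      using p(1) nz by (auto simp: ps_def)
    then have "a * q * q^N = p"
      using p(2) q_nz by (simp add: power_int_minus field_simps)
    then show ?thesis
      using p(1) by blast
  qed
  interpret terminating_cf q a X ps N
  proof
    show "X * prod_list ps = a^2 * q"
      using nz q_nz by (simp add: X_def s ps_def field_simps eval_nat_numeral)
    show "0 \<notin> set ps"
      using nz by (auto simp: ps_def)
  qed (use q nz s_nz q_nz aX_denom a_denom X_denom p_denom terminating in \<open>auto simp: X_def ps_def\<close>)
  have "cf_tail \<alpha> \<beta> 0 N * Y 0 = 1"
    using cf_tail_Y[of 0 N] cf_denoms unfolding \<alpha> \<beta> s_X ps_def by simp
  then have "1 / cf_tail \<alpha> \<beta> 0 N = Y 0"
    by (metis mult_zero_left nonzero_mult_div_cancel_left zero_neq_one)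
  moreover have "1 / X = a * q^2 / s" "1 / (q*X) = a*q / s"
    using q_nz by (simp_all add: X_def power2_eq_square)
  moreover have "R 1 = (1 - b) * (1 - c) * (1 - d) * (1 - e) * (1 - f)"
    unfolding R_def by (simp add: ps_def mult.assoc)
  ultimately show ?thesis
    using Y_0 by (simp add: ps_def)
qed

end
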